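(* Let $k\ge 1$ and let $X=(x_1,\dots,x_n)\in S_n$ be an access sequence that avoids at least one permutation of length $k$ (i.e. $X\in\mathcal{C}_k$). Then for every initial tree $T$ on $[n]$, the cost of \textsc{Greedy} on $X$ with initial tree $T$ satisfies $|\textsc{Greedy}_T(X)|\le n\,2^{\alpha(n)^{O(k)}}$, where $\alpha$ is the inverse Ackermann function and the $O(\cdot)$ hides an absolute constant.
   Context: Pattern avoidance: $S_k$ is the set of permutations of $[k]$, written as sequences. A permutation $X\in S_n$ contains $\pi\in S_k$ if there are indices $i_1<\dots<i_k$ such that $(x_{i_1},\dots,x_{i_k})$ is order-isomorphic to $\pi$ (same pairwise comparisons); otherwise $X$ avoids $\pi$. Geometric BST model: keys are $[n]=\{1,\dots,n\}$; key $x_t$ is accessed at time $t$, and $X$ is identified with the set of access points $\{(x_t,t)\}\subset\mathbb{Z}^2$ (first coordinate = key, second = time). For points $p,q$, $\square_{pq}$ is the closed axis-parallel rectangle with corners $p,q$. A point set $S$ is satisfied if for all $p,q\in S$ differing in both coordinates there is $r\in S\cap\square_{pq}\setminus\{p,q\}$. An initial tree is a BST $T$ on $[n]$ of depth $d$ (root at depth 1); it is represented by the point set containing, for each key $x$ of depth $d(x)$, the points $(x,s)$ for $s=1-d,\dots,1-d(x)$. An online geometric BST algorithm outputs, row by row (row $t$ decided knowing only $T$ and $x_1,\dots,x_t$), a set $\mathcal{A}_T(X)\subseteq[n]\times[n]$ with $X\subseteq\mathcal{A}_T(X)$ and $\mathcal{A}_T(X)\cup T$ satisfied; its cost is $|\mathcal{A}_T(X)|$.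 \textsc{Greedy}: let $\tau(b,t)$ be the largest time $\le t$ at which column $b$ contains a point of $T$ or of the output so far (undefined if none). At time $t$ with access point $(a,t)$, \textsc{Greedy} adds $(a,t)$ and $(b,t)$ for every key $b\neq a$ with $\tau(b,t-1)$ defined such that $\square_{(a,t),(b,\tau(b,t-1))}$ contains no point of $T\cup\{$output points at times $<t\}$ other than $(b,\tau(b,t-1))$. $\textsc{Greedy}_T(X)$ is the resulting output. *)

theory Defs
  imports Complex_Main "HOL-Library.Tree" "HOL-Combinatorics.Multiset_Permutations"
begin

text \<open>Permutations of \<open>[n]\<close>, written as sequences, are the lists in
  \<^term>\<open>permutations_of_set {1..n}\<close>; list positions are counted from 0.\<close>

definition contains_pattern :: "nat list \<Rightarrow> nat list \<Rightarrow> bool" where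
  "contains_pattern X \<pi> \<longleftrightarrow>
     (\<exists>i :: nat \<Rightarrow> nat.
        strict_mono_on {..<length \<pi>} i \<and>
        (\<forall>a<length \<pi>. i a < length X) \<and>
        (\<forall>a<length \<pi>. \<forall>b<length \<pi>. X ! i a < X ! i b \<longleftrightarrow> \<pi> ! a < \<pi> ! b))"

abbreviation avoids_pattern :: "nat list \<Rightarrow> nat list \<Rightarrow> bool" where
  "avoids_pattern X \<pi> \<equiv> \<not> contains_pattern X \<pi>"

text \<open>The inverse of the diagonal of the two-argument Ackermann--Peter function. Values start
  at 1, so that \<open>O(\<cdot>)\<close> in an exponent over this base is monotone in the hidden constant.\<close>

fun ackermann :: "nat \<Rightarrow> nat \<Rightarrow> nat" where
  "ackermann 0 n = Suc n"
| "ackermann (Suc m) 0 = ackermann m 1"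
| "ackermann (Suc m) (Suc n) = ackermann m (ackermann (Suc m) n)"

definition inverse_ackermann :: "nat \<Rightarrow> nat" where
  "inverse_ackermann n = (LEAST m. 1 \<le> m \<and> n \<le> ackermann m m)"

lemma less_ackermann: "n < ackermann m n"
  by (induction m n rule: ackermann.induct) auto

lemma inverse_ackermann_props:
  "1 \<le> inverse_ackermann n" "n \<le> ackermann (inverse_ackermann n) (inverse_ackermann n)"
proof -
  have "1 \<le> Suc n \<and> n \<le> ackermann (Suc n) (Suc n)"
    using less_ackermann[of "Suc n" "Suc n"] by auto
  then have "1 \<le> inverse_ackermann n \<and>
      n \<le> ackermann (inverse_ackermann n) (inverse_ackermann n)"
    unfolding inverse_ackermann_def by (rule LeastI)
  then show "1 \<le> inverse_ackermann n"
    "n \<le> ackermann (inverse_ackermann n) (inverse_ackermann n)" by auto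
qed

text \<open>A point is a pair (key, time).\<close>

type_synonym point = "nat \<times> int"

definition rect :: "point \<Rightarrow> point \<Rightarrow> point set" where
  "rect p q = {min (fst p) (fst q)..max (fst p) (fst q)} \<times> {min (snd p) (snd q)..max (snd p) (snd q)}"

text \<open>The root has depth 1, so \<^const>\<open>height\<close> is the depth of the tree. The value is meaningful
  only for keys of a binary search tree.\<close>

fun key_depth :: "nat tree \<Rightarrow> nat \<Rightarrow> nat" where
  "key_depth \<langle>\<rangle> x = 0"
| "key_depth \<langle>l, a, r\<rangle> x =
     (if x = a then 1 else if x < a then 1 + key_depth l x else 1 + key_depth r x)"

definition tree_points :: "nat tree \<Rightarrow> point set" where
  "tree_points T =
     {(x, s). x \<in> set_tree T \<and> 1 - int (height T) \<le> s \<and> s \<le> 1 - int (key_depth T x)}"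

definition touch_times :: "point set \<Rightarrow> nat \<Rightarrow> int \<Rightarrow> int set" where
  "touch_times S b t = {s. s \<le> t \<and> (b, s) \<in> S}"

text \<open>Meaningful only if \<^term>\<open>touch_times S b t\<close> is nonempty.\<close>

definition last_touch :: "point set \<Rightarrow> nat \<Rightarrow> int \<Rightarrow> int" where
  "last_touch S b t = Max (touch_times S b t)"

text \<open>The row produced by Greedy at time \<open>t\<close> for access key \<open>a\<close>, where \<open>S\<close> consists of the points
  of the initial tree and the output points at times before \<open>t\<close>.\<close>

definition greedy_row :: "point set \<Rightarrow> nat \<Rightarrow> int \<Rightarrow> point set" where
  "greedy_row S a t =
     insert (a, t)
       {(b, t) | b. b \<noteq> a \<and> touch_times S b (t - 1) \<noteq> {} \<and>
          rect (a, t) (b, last_touch S b (t - 1)) \<inter> S \<subseteq> {(b, last_touch S b (t - 1))}}"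

fun greedy_upto :: "nat tree \<Rightarrow> nat list \<Rightarrow> nat \<Rightarrow> point set" where
  "greedy_upto T X 0 = {}"
| "greedy_upto T X (Suc t) =
     greedy_upto T X t \<union>
     greedy_row (tree_points T \<union> greedy_upto T X t) (X ! t) (int (Suc t))"

definition greedy :: "nat tree \<Rightarrow> nat list \<Rightarrow> point set" where
  "greedy T X = greedy_upto T X (length X)"

lemma greedy_upto_subset:
  assumes "t \<le> length X"
  shows "greedy_upto T X t \<subseteq> (set X \<union> set_tree T) \<times> {1..int t}"
  using assms
proof (induction t)
  case (Suc t)
  let ?K = "set X \<union> set_tree T"
  have IH: "greedy_upto T X t \<subseteq> ?K \<times> {1..int t}"
    using Suc by simp
  have "X ! t \<in> set X"
    using Suc.prems by simp
  moreover have "b \<in> ?K" if "(b, s) \<in> tree_points T \<union> greedy_upto T X t" for b s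
    using that IH by (auto simp: tree_points_def)
  ultimately have
    "greedy_row (tree_points T \<union> greedy_upto T X t) (X ! t) (int (Suc t)) \<subseteq> ?K \<times> {1..int (Suc t)}"
    unfolding greedy_row_def touch_times_def by fastforce
  with IH show ?case
    by fastforce
qed simp

lemma finite_greedy: "finite (greedy T X)"
proof (rule finite_subset)
  show "greedy T X \<subseteq> (set X \<union> set_tree T) \<times> {1..int (length X)}"
    unfolding greedy_def by (rule greedy_upto_subset) simp
qed auto

end

theory Submission
  imports Defs
begin

text \<open>View the output of Greedy as a 0-1 matrix whose rows are times and whose columns are keys.
  If \<open>a < b < c\<close>, keys \<open>a\<close> and \<open>c\<close> are touched at time \<open>s\<close> and \<open>b\<close> at a later time \<open>t\<close>, then some
  key in \<open>{a..c}\<close> is accessed during \<open>(s, t]\<close>. Hence \<open>2k\<close> rows that all meet each of \<open>3k\<close>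
  consecutive key intervals force every pattern of length \<open>k\<close> in the access sequence: the element
  \<open>\<pi>\<^sub>i\<close> is found between the rows \<open>2i\<close> and \<open>2i + 1\<close>, in the \<open>\<pi>\<^sub>i\<close>-th triple of intervals.

  The number of ones in a matrix without such a formation is bounded by the method of
  Davenport--Schinzel theory. Bound the number of rows with at least \<open>q\<close> ones by cutting the columns
  into groups. A row has all its ones in one group, or has many ones in some group and another one
  to the right or left of it (so that these rows, restricted to that group, avoid formations with one
  interval fewer), or is sparse in every group and keeps many ones when each group is contracted
  to a column. Nesting this along the recursion of the Ackermann function multiplies \<open>q\<close> by the
  value for one interval fewer once per level, so that \<open>\<alpha>(n)\<close> levels for each of the \<open>3k\<close>
  intervals give \<open>q = 2 ^ (\<alpha>(n) ^ O(k))\<close>.\<close>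

section \<open>Formations and the count of long rows\<close>

text \<open>The formations of Davenport-Schinzel theory, with the intervals given by their cut
  positions. As \<open>c\<close> is total on \<open>nat\<close>, every construction must keep it
  monotone beyond index \<open>s\<close> too.\<close>

definition formation :: "nat \<Rightarrow> 'a set \<Rightarrow> ('a \<Rightarrow> nat set) \<Rightarrow> bool" where
  "formation s R f \<longleftrightarrow> (\<exists>c. mono c \<and> (\<forall>x\<in>R. \<forall>i<s. f x \<inter> {c i..<c (Suc i)} \<noteq> {}))"

definition formation_free :: "nat \<Rightarrow> nat \<Rightarrow> 'a set \<Rightarrow> ('a \<Rightarrow> nat set) \<Rightarrow> bool" where
  "formation_free r s R f \<longleftrightarrow> (\<forall>R'\<subseteq>R. card R' = r \<longrightarrow> \<not> formation s R' f)"

text \<open>Rows are abstract labels, and \<open>U\<close> fixes their type, which the numeric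
  arguments do not determine. The bound is proportional to the width \<open>b - a\<close>, so that
  bounds for disjoint groups of columns add up.\<close>

definition few_rows :: "'a set \<Rightarrow> nat \<Rightarrow> nat \<Rightarrow> nat \<Rightarrow> nat \<Rightarrow> nat \<Rightarrow> bool" where
  "few_rows U r s q C n \<longleftrightarrow>
     (\<forall>a b R f. R \<subseteq> U \<longrightarrow> finite R \<longrightarrow> a \<le> b \<longrightarrow> b - a \<le> n \<longrightarrow>
        (\<forall>x\<in>R. f x \<subseteq> {a..<b} \<and> q \<le> card (f x)) \<longrightarrow> formation_free r s R f \<longrightarrow>
        card R \<le> C * (b - a))"

lemma few_rowsD:
  assumes "few_rows U r s q C n" "R \<subseteq> U" "finite R" "a \<le> b" "b - a \<le> n"
    "\<And>x. x \<in> R \<Longrightarrow> f x \<subseteq> {a..<b}" "\<And>x. x \<in> R \<Longrightarrow> q \<le> card (f x)" "formation_free r s R f"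
  shows "card R \<le> C * (b - a)"
  using assms(1)[unfolded few_rows_def, rule_format, of R a b f] assms(2-) by simp

lemma few_rows_mono:
  assumes "few_rows U r s q C n" "q \<le> q'" "C \<le> C'" "n' \<le> n"
  shows "few_rows U r s q' C' n'"
  unfolding few_rows_def
proof (intro allI impI)
  fix a b R and f :: "'a \<Rightarrow> nat set"
  assume *: "R \<subseteq> U" "finite R" "a \<le> b" "b - a \<le> n'"
    "\<forall>x\<in>R. f x \<subseteq> {a..<b} \<and> q' \<le> card (f x)" "formation_free r s R f"
  then have "card R \<le> C * (b - a)"
    using assms by (intro few_rowsD[OF assms(1), where f = f]) auto
  then show "card R \<le> C' * (b - a)"
    using assms(3) by (meson le_trans mult_le_mono1)
qed

lemma formation_free_mono:
  assumes "formation_free r s R f" "R' \<subseteq> R" "\<And>x. x \<in> R' \<Longrightarrow> g x \<subseteq> f x"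
  shows "formation_free r s R' g"
  unfolding formation_free_def
proof (intro allI impI notI)
  fix S assume S: "S \<subseteq> R'" "card S = r" "formation s S g"
  then have "formation s S f"
    unfolding formation_def using assms(3) by fast
  then show False
    using assms S unfolding formation_free_def by blast
qed

section \<open>Extending and contracting formations\<close>

text \<open>Cuts clipped at \<open>b\<close> still serve \<open>g\<close>, which stays below
  \<open>b\<close>. The new last interval stretches past one later element of each row; it has a
  finite end because \<open>R\<close> is finite.\<close>

lemma formation_Suc_append:
  assumes "formation s R g" "finite R"
    and sub: "\<And>x. x \<in> R \<Longrightarrow> g x \<subseteq> f x \<inter> {..<b}"
    and later: "\<And>x. x \<in> R \<Longrightarrow> \<exists>y\<in>f x. b \<le> y"
  shows "formation (Suc s) R f"
proof -
  obtain c where c: "mono c" "\<And>x i. x \<in> R \<Longrightarrow> i < s \<Longrightarrow> g x \<inter> {c i..<c (Suc i)} \<noteq> {}"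
    using assms(1) unfolding formation_def by blast
  obtain h where h: "\<And>x. x \<in> R \<Longrightarrow> h x \<in> f x \<and> b \<le> h x"
    using later by metis
  \<comment> \<open>The sum bounds every chosen \<open>h x\<close>; the summand \<open>b\<close>
    keeps the cuts monotone.\<close>
  define m where "m = Suc (b + sum h R)"
  have m: "h x < m" if "x \<in> R" for x
    using member_le_sum[OF that, of h] assms(2) unfolding m_def by simp
  define c' where "c' i = (if i \<le> s then min (c i) b else m)" for i
  have "mono c'"
    unfolding mono_iff_le_Suc c'_def m_def
    using monoD[OF c(1), of i "Suc i" for i] by (auto simp: min_def intro: le_trans)
  moreover have "f x \<inter> {c' i..<c' (Suc i)} \<noteq> {}" if x: "x \<in> R" and i: "i < Suc s" for x i
  proof (cases "i < s")
    case True
    obtain y where "y \<in> g x" "c i \<le> y" "y < c (Suc i)"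
      using c(2)[OF x True] by auto
    with sub[OF x] True have "y \<in> f x \<inter> {c' i..<c' (Suc i)}"
      by (auto simp: c'_def)
    then show ?thesis by blast
  next
    case False
    with i have "h x \<in> f x \<inter> {c' i..<c' (Suc i)}"
      using h[OF x] m[OF x] by (auto simp: c'_def)
    then show ?thesis by blast
  qed
  ultimately show ?thesis unfolding formation_def by blast
qed

lemma formation_Suc_prepend:
  assumes "formation s R g"
    and sub: "\<And>x. x \<in> R \<Longrightarrow> g x \<subseteq> f x \<inter> {b..}"
    and earlier: "\<And>x. x \<in> R \<Longrightarrow> \<exists>y\<in>f x. y < b"
  shows "formation (Suc s) R f"
proof -
  obtain c where c: "mono c" "\<And>x i. x \<in> R \<Longrightarrow> i < s \<Longrightarrow> g x \<inter> {c i..<c (Suc i)} \<noteq> {}"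
    using assms(1) unfolding formation_def by blast
  define c' where "c' i = (case i of 0 \<Rightarrow> 0 | Suc j \<Rightarrow> max (c j) b)" for i
  have "mono c'"
    unfolding mono_iff_le_Suc c'_def
    using monoD[OF c(1), of i "Suc i" for i] by (auto split: nat.split intro: max.mono le_max_iff_disj[THEN iffD2])
  moreover have "f x \<inter> {c' i..<c' (Suc i)} \<noteq> {}" if x: "x \<in> R" and i: "i < Suc s" for x i
  proof (cases i)
    case 0
    then show ?thesis
      using earlier[OF x] by (force simp: c'_def)
  next
    case (Suc j)
    obtain y where "y \<in> g x" "c j \<le> y" "y < c (Suc j)"
      using c(2)[OF x, of j] i Suc by auto
    with sub[OF x] Suc have "y \<in> f x \<inter> {c' i..<c' (Suc i)}"
      by (auto simp: c'_def)
    then show ?thesis by blast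
  qed
  ultimately show ?thesis unfolding formation_def by blast
qed

text \<open>Contracting groups of width \<open>t\<close> creates no formations: a cut
  \<open>c i\<close> between groups pulls back to the cut \<open>a + c i * t\<close>. Assumption
  \<open>ge\<close> keeps the truncated subtraction \<open>y - a\<close> faithful.\<close>

lemma formation_contract:
  assumes "formation s R (\<lambda>x. (\<lambda>y. (y - a) div t) ` f x)" "0 < t"
    and ge: "\<And>x. x \<in> R \<Longrightarrow> f x \<subseteq> {a..}"
  shows "formation s R f"
proof -
  obtain c where c: "mono c"
    "\<And>x i. x \<in> R \<Longrightarrow> i < s \<Longrightarrow> (\<lambda>y. (y - a) div t) ` f x \<inter> {c i..<c (Suc i)} \<noteq> {}"
    using assms(1) unfolding formation_def by blast
  have "mono (\<lambda>i. a + c i * t)"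
    using c(1) by (simp add: mono_def)
  moreover have "f x \<inter> {a + c i * t..<a + c (Suc i) * t} \<noteq> {}" if x: "x \<in> R" and i: "i < s" for x i
  proof -
    obtain y where y: "y \<in> f x" "c i \<le> (y - a) div t" "(y - a) div t < c (Suc i)"
      using c(2)[OF x i] by auto
    have "a \<le> y" using ge[OF x] y(1) by auto
    moreover have "c i * t \<le> y - a" "y - a < c (Suc i) * t"
      using y(2,3) assms(2) by (simp_all add: less_eq_div_iff_mult_less_eq div_less_iff_less_mult)
    ultimately have "y \<in> f x \<inter> {a + c i * t..<a + c (Suc i) * t}"
      using y(1) by auto
    then show ?thesis by blast
  qed
  ultimately show ?thesis unfolding formation_def by blast
qed

section \<open>Recurrences in the number of intervals and in the width\<close>

text \<open>This trades one interval for ones outside the column range: a formation inside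
  \<open>{a..<b}\<close> would be prolonged by the ones at or beyond \<open>b\<close>, so the count
  for \<open>s\<close> intervals applies to the restricted rows.\<close>

lemma few_rows_later:
  assumes few: "few_rows U r s q C n" and r: "0 < r"
    and R: "R \<subseteq> U" "finite R" "formation_free r (Suc s) R f"
    and ab: "a \<le> b" "b - a \<le> n"
  shows "card {x \<in> R. q \<le> card (f x \<inter> {a..<b}) \<and> (\<exists>y\<in>f x. b \<le> y)} \<le> C * (b - a)"
proof (rule few_rowsD[OF few, where f = "\<lambda>x. f x \<inter> {a..<b}"])
  show "formation_free r s {x \<in> R. q \<le> card (f x \<inter> {a..<b}) \<and> (\<exists>y\<in>f x. b \<le> y)}
      (\<lambda>x. f x \<inter> {a..<b})"
    unfolding formation_free_def
  proof (intro allI impI notI)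
    fix S assume S: "S \<subseteq> {x \<in> R. q \<le> card (f x \<inter> {a..<b}) \<and> (\<exists>y\<in>f x. b \<le> y)}" "card S = r"
      and F: "formation s S (\<lambda>x. f x \<inter> {a..<b})"
    have "finite S" using S(2) r by (simp add: card_ge_0_finite)
    then have "formation (Suc s) S f"
      using S(1) by (intro formation_Suc_append[OF F, where b = b]) auto
    then show False
      using R(3) S unfolding formation_free_def by blast
  qed
qed (use R ab in auto)

lemma few_rows_earlier:
  assumes few: "few_rows U r s q C n"
    and R: "R \<subseteq> U" "finite R" "formation_free r (Suc s) R f"
    and ab: "a \<le> b" "b - a \<le> n"
  shows "card {x \<in> R. q \<le> card (f x \<inter> {a..<b}) \<and> (\<exists>y\<in>f x. y < a)} \<le> C * (b - a)"
proof (rule few_rowsD[OF few, where f = "\<lambda>x. f x \<inter> {a..<b}"])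
  show "formation_free r s {x \<in> R. q \<le> card (f x \<inter> {a..<b}) \<and> (\<exists>y\<in>f x. y < a)}
      (\<lambda>x. f x \<inter> {a..<b})"
    unfolding formation_free_def
  proof (intro allI impI notI)
    fix S assume S: "S \<subseteq> {x \<in> R. q \<le> card (f x \<inter> {a..<b}) \<and> (\<exists>y\<in>f x. y < a)}" "card S = r"
      and F: "formation s S (\<lambda>x. f x \<inter> {a..<b})"
    have "formation (Suc s) S f"
      using S(1) by (intro formation_Suc_prepend[OF F, where b = a]) auto
    then show False
      using R(3) S unfolding formation_free_def by blast
  qed
qed (use R ab in auto)

text \<open>Any \<open>r\<close> rows with ones in \<open>{a..<b}\<close> already form a formation
  with a single interval, so there are fewer than \<open>r\<close> rows.\<close>

lemma few_rows_1:
  assumes "0 < r" "0 < q"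
  shows "few_rows U r 1 q r n"
  unfolding few_rows_def
proof (intro allI impI)
  fix a b R and f :: "'a \<Rightarrow> nat set"
  assume R: "finite R" "a \<le> b" "\<forall>x\<in>R. f x \<subseteq> {a..<b} \<and> q \<le> card (f x)"
    and free: "formation_free r 1 R f"
  have ne: "f x \<inter> {a..<b} \<noteq> {}" if "x \<in> R" for x
    using R(3) that assms(2) by (metis Int_absorb2 card.empty leD)
  show "card R \<le> r * (b - a)"
  proof (cases "R = {}")
    case False
    then have "a < b" using ne R(2) by fastforce
    have "card R < r"
    proof (rule ccontr)
      assume "\<not> card R < r"
      then obtain S where S: "S \<subseteq> R" "card S = r"
        by (meson obtain_subset_with_card_n not_less)
      have "mono (\<lambda>i::nat. if i = 0 then a else b)"
        using \<open>a < b\<close> by (auto simp: mono_def)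
      then have "formation 1 S f"
        unfolding formation_def using ne S(1) by (intro exI[of _ "\<lambda>i. if i = 0 then a else b"]) auto
      then show False using free S unfolding formation_free_def by blast
    qed
    also have "r * 1 \<le> r * (b - a)" using \<open>a < b\<close> by (intro mult_le_mono2) simp
    finally show ?thesis by simp
  qed simp
qed

text \<open>The crude bound that starts the recursion. Columns are stripped from the right; a row
  with a one in the last column has at least \<open>q\<close> ones before it, so
  \<open>few_rows_later\<close> charges each column at most \<open>C * m\<close>.\<close>

lemma few_rows_Suc_quadratic:
  assumes few: "few_rows U r s q C n" and r: "0 < r" and mn: "m \<le> n"
  shows "few_rows U r (Suc s) (Suc q) (C * m) m"
proof -
  have *: "card R \<le> C * m * (b - a)"
    if "R \<subseteq> U" "finite R" "a \<le> b" "b - a \<le> m"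
      "\<And>x. x \<in> R \<Longrightarrow> f x \<subseteq> {a..<b}" "\<And>x. x \<in> R \<Longrightarrow> Suc q \<le> card (f x)"
      "formation_free r (Suc s) R f" for a b R and f :: "'a \<Rightarrow> nat set"
    using \<open>a \<le> b\<close> that
  proof (induction b arbitrary: R rule: dec_induct)
    case base
    then have "R = {}" by fastforce
    then show ?case by simp
  next
    case (step b)
    define A where "A = {x \<in> R. f x \<subseteq> {a..<b}}"
    define B where "B = {x \<in> R. q \<le> card (f x \<inter> {a..<b}) \<and> (\<exists>y\<in>f x. b \<le> y)}"
    have "card A \<le> C * m * (b - a)"
    proof (rule step.IH)
      show "formation_free r (Suc s) A f"
        using formation_free_mono[OF step.prems(7)] by (auto simp: A_def)
    qed (use step.prems step.hyps in \<open>auto simp: A_def\<close>)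
    moreover have "card B \<le> C * (b - a)"
      unfolding B_def using step.prems step.hyps mn
      by (intro few_rows_later[OF few r]) auto
    moreover have "C * (b - a) \<le> C * m" using step.prems(4) by (intro mult_le_mono2) simp
    moreover have "R \<subseteq> A \<union> B"
    proof
      fix x assume x: "x \<in> R"
      have sub: "f x \<subseteq> {a..<Suc b}" using step.prems x by blast
      show "x \<in> A \<union> B"
      proof (cases "b \<in> f x")
        case True
        then have "f x \<inter> {a..<b} = f x - {b}" using sub by auto
        then have "card (f x \<inter> {a..<b}) = card (f x) - 1"
          using True by simp
        then show ?thesis
          using x True step.prems(6)[OF x] by (force simp: B_def)
      next
        case False
        then have "f x \<subseteq> {a..<b}"
          using sub by (force simp: less_Suc_eq)
        then show ?thesis using x by (simp add: A_def)
      qed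
    qed
    moreover have "finite A" "finite B"
      using step.prems by (auto simp: A_def B_def)
    ultimately have "card R \<le> C * m * (b - a) + C * m"
      using card_mono[of "A \<union> B" R] card_Un_le[of A B] by (meson add_mono finite_UnI le_trans)
    also have "\<dots> = C * m * (Suc b - a)" using step.hyps by (simp add: Suc_diff_le)
    finally show ?case .
  qed
  show ?thesis unfolding few_rows_def by (intro allI impI, rule *) simp_all
qed

lemma card_UN_groups_le:
  fixes lo :: "nat \<Rightarrow> nat"
  assumes "mono lo" "\<And>g. g < G \<Longrightarrow> card (A g) \<le> D * (lo (Suc g) - lo g)"
  shows "card (\<Union>g<G. A g) \<le> D * (lo G - lo 0)"
proof -
  have "card (\<Union>g<G. A g) \<le> (\<Sum>g<G. card (A g))"
    by (rule card_UN_le) simp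
  also have "\<dots> \<le> (\<Sum>g<G. D * (lo (Suc g) - lo g))"
    using assms(2) by (intro sum_mono) auto
  also have "\<dots> = D * (\<Sum>g<G. lo (Suc g) - lo g)"
    by (simp add: sum_distrib_left)
  also have "(\<Sum>g<G. lo (Suc g) - lo g) = lo G - lo 0"
  proof (induction G)
    case (Suc G)
    have "lo 0 \<le> lo G" "lo G \<le> lo (Suc G)"
      using assms(1) by (auto simp: mono_def)
    then show ?case using Suc by simp
  qed simp
  finally show ?thesis .
qed

text \<open>The coarse matrix has one column per group of width \<open>t\<close>. Its cost per
  column may grow with \<open>t\<close>, since there are fewer groups by about that factor. In the
  result, \<open>D\<close> pays for rows inside one group, \<open>2 * C\<close> for rows with
  \<open>Q\<close> ones in a group and another one beyond it, and \<open>4 * D'\<close> for rows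
  sparse in all groups.\<close>

lemma few_rows_Suc_step:
  assumes few: "few_rows U r s Q C n" and r: "0 < r" and Q: "0 < Q" and t: "2 \<le> t"
    and small: "few_rows U r (Suc s) (q * Q) D (min n t)"
    and coarse: "few_rows U r (Suc s) q (D' * Suc t) (min n M)"
  shows "few_rows U r (Suc s) (q * Q) (D + 4 * D' + 2 * C) (min n M)"
  unfolding few_rows_def
proof (intro allI impI)
  fix a b R and f :: "'a \<Rightarrow> nat set"
  assume R: "R \<subseteq> U" "finite R" and ab: "a \<le> b" "b - a \<le> min n M"
    and f: "\<forall>x\<in>R. f x \<subseteq> {a..<b} \<and> q * Q \<le> card (f x)"
    and free: "formation_free r (Suc s) R f"
  let ?m = "b - a"
  show "card R \<le> (D + 4 * D' + 2 * C) * ?m"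
  proof (cases "?m \<le> t")
    case True
    then have "card R \<le> D * ?m"
      using R ab f free by (intro few_rowsD[OF small, where f = f]) auto
    also have "\<dots> \<le> (D + 4 * D' + 2 * C) * ?m"
      by (intro mult_le_mono1) simp
    finally show ?thesis .
  next
    case False
    \<comment> \<open>The last group is clipped at \<open>b\<close> and may be empty.\<close>
    define G where "G = Suc (?m div t)"
    define lo where "lo g = min b (a + g * t)" for g
    have mono: "mono lo"
      unfolding lo_def by (intro monoI min.mono) auto
    have lo_Suc: "lo g \<le> lo (Suc g)" for g
      using mono by (simp add: mono_def)
    have width: "lo (Suc g) - lo g \<le> t" for g
      unfolding lo_def by (auto simp: min_def)
    have lo_0: "lo 0 = a"
      unfolding lo_def using ab by simp
    have "?m < G * t"
      unfolding G_def using t by (simp add: dividend_less_div_times)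
    then have lo_G: "lo G = b"
      unfolding lo_def by simp
    let ?I = "\<lambda>g. {lo g..<lo (Suc g)}"
    let ?p = "\<lambda>y. (y - a) div t"
    have group: "?p y < G" "y \<in> ?I (?p y)" if "y \<in> {a..<b}" for y
    proof -
      have "?p y \<le> ?m div t" using that by (intro div_le_mono) auto
      then show "?p y < G" by (simp add: G_def)
      have "?p y * t \<le> y - a" "y - a < Suc (?p y) * t"
        using t dividend_less_div_times[of t "y - a"] by (simp_all add: add.commute)
      then have "a + ?p y * t \<le> y" "y < a + Suc (?p y) * t" using that by (simp_all only: atLeastLessThan_iff) linarith+
      then show "y \<in> ?I (?p y)" using that by (auto simp: lo_def)
    qed
    define A where "A g = {x \<in> R. f x \<subseteq> ?I g}" for g
    define L where "L g = {x \<in> R. Q \<le> card (f x \<inter> ?I g) \<and> (\<exists>y\<in>f x. lo (Suc g) \<le> y)}" for g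
    define E where "E g = {x \<in> R. Q \<le> card (f x \<inter> ?I g) \<and> (\<exists>y\<in>f x. y < lo g)}" for g
    define S where "S = {x \<in> R. \<forall>g<G. card (f x \<inter> ?I g) < Q}"
    have wn: "lo (Suc g) - lo g \<le> n" for g
      using width[of g] False ab(2) by simp
    have "card (A g) \<le> D * (lo (Suc g) - lo g)" for g
    proof (rule few_rowsD[OF small, where f = f])
      show "formation_free r (Suc s) (A g) f"
        using formation_free_mono[OF free] by (auto simp: A_def)
    qed (use R f lo_Suc width wn in \<open>auto simp: A_def\<close>)
    from card_UN_groups_le[OF mono this, of G] have cA: "card (\<Union>g<G. A g) \<le> D * ?m"
      by (simp add: lo_0 lo_G)
    have "card (L g) \<le> C * (lo (Suc g) - lo g)" for g
      unfolding L_def by (intro few_rows_later[OF few r] R free lo_Suc wn)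
    from card_UN_groups_le[OF mono this, of G] have cL: "card (\<Union>g<G. L g) \<le> C * ?m"
      by (simp add: lo_0 lo_G)
    have "card (E g) \<le> C * (lo (Suc g) - lo g)" for g
      unfolding E_def by (intro few_rows_earlier[OF few] R free lo_Suc wn)
    from card_UN_groups_le[OF mono this, of G] have cE: "card (\<Union>g<G. E g) \<le> C * ?m"
      by (simp add: lo_0 lo_G)
    \<comment> \<open>As \<open>2 \<le> t\<close> and \<open>t < ?m\<close>, there are at most
      \<open>?m\<close> groups, so the contracted matrix is within the width allowed by
      \<open>coarse\<close>.\<close>
    have "?m div t \<le> ?m div 2"
      using t by (intro div_le_mono2) auto
    then have Gm: "G \<le> ?m"
      using False t unfolding G_def by linarith
    have "card S \<le> D' * Suc t * (G - 0)"
    proof (rule few_rowsD[OF coarse, where f = "\<lambda>x. ?p ` f x"])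
      show "?p ` f x \<subseteq> {0..<G}" if "x \<in> S" for x
        using that f group(1) unfolding S_def by fastforce
      show "q \<le> card (?p ` f x)" if "x \<in> S" for x
      proof -
        have x: "x \<in> R" and sparse: "\<And>g. g < G \<Longrightarrow> card (f x \<inter> ?I g) < Q"
          using that by (auto simp: S_def)
        have fx: "f x \<subseteq> {a..<b}" using f x by blast
        then have fin: "finite (f x)" by (rule finite_subset) simp
        \<comment> \<open>With fewer than \<open>Q\<close> ones in each group, \<open>q * Q\<close>
          ones must be spread over at least \<open>q\<close> groups.\<close>
        have "f x \<subseteq> (\<Union>g\<in>?p ` f x. f x \<inter> ?I g)"
          using fx group(2) by blast
        then have "card (f x) \<le> card (\<Union>g\<in>?p ` f x. f x \<inter> ?I g)"
          using fin by (intro card_mono) auto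
        also have "\<dots> \<le> (\<Sum>g\<in>?p ` f x. card (f x \<inter> ?I g))"
          using fin by (intro card_UN_le) auto
        also have "\<dots> \<le> (\<Sum>g\<in>?p ` f x. Q)"
          using fx group(1) sparse by (intro sum_mono) (auto intro!: less_imp_le)
        finally have "card (f x) \<le> card (?p ` f x) * Q"
          by simp
        moreover have "q * Q \<le> card (f x)" using f x by blast
        ultimately show ?thesis using Q by (meson le_trans mult_le_cancel2)
      qed
      show "formation_free r (Suc s) S (\<lambda>x. ?p ` f x)"
        unfolding formation_free_def
      proof (intro allI impI notI)
        fix R' assume R': "R' \<subseteq> S" "card R' = r" and F: "formation (Suc s) R' (\<lambda>x. ?p ` f x)"
        have "f x \<subseteq> {a..}" if "x \<in> R'" for x
          using R'(1) f that unfolding S_def by fastforce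
        with F t have "formation (Suc s) R' f"
          by (intro formation_contract[OF F]) auto
        then show False
          using free R' unfolding formation_free_def S_def by blast
      qed
    qed (use R Gm ab in \<open>auto simp: S_def\<close>)
    also have "\<dots> = D' * (Suc t * G)" by (simp only: mult.assoc diff_zero)
    \<comment> \<open>About \<open>?m div t\<close> groups at cost \<open>Suc t\<close> each are
      linear in \<open>?m\<close>; \<open>t < ?m\<close> absorbs the rounding.\<close>
    also have "\<dots> \<le> D' * (4 * ?m)"
    proof (rule mult_le_mono2)
      have "Suc t * G = t * (?m div t) + ?m div t + t + 1"
        by (simp add: G_def algebra_simps)
      moreover have "t * (?m div t) \<le> ?m" "?m div t \<le> ?m" by simp_all
      ultimately show "Suc t * G \<le> 4 * ?m" using False by linarith
    qed
    finally have cS: "card S \<le> 4 * D' * ?m" by simp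
    have cover: "R \<subseteq> ((\<Union>g<G. A g) \<union> (\<Union>g<G. L g)) \<union> ((\<Union>g<G. E g) \<union> S)"
    proof
      fix x assume x: "x \<in> R"
      show "x \<in> ((\<Union>g<G. A g) \<union> (\<Union>g<G. L g)) \<union> ((\<Union>g<G. E g) \<union> S)"
      proof (cases "x \<in> S")
        case False
        then obtain g where g: "g < G" "Q \<le> card (f x \<inter> ?I g)"
          using x by (auto simp: S_def not_less)
        have "x \<in> A g \<or> x \<in> L g \<or> x \<in> E g"
        proof (cases "f x \<subseteq> ?I g")
          case False
          then obtain y where "y \<in> f x" "y < lo g \<or> lo (Suc g) \<le> y" by force
          then show ?thesis using x g by (auto simp: L_def E_def)
        qed (use x in \<open>simp add: A_def\<close>)
        then show ?thesis using g(1) by blast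
      qed simp
    qed
    have "card R \<le> card (((\<Union>g<G. A g) \<union> (\<Union>g<G. L g)) \<union> ((\<Union>g<G. E g) \<union> S))"
      using R(2) by (intro card_mono[OF _ cover]) (auto simp: A_def L_def E_def S_def)
    also have "\<dots> \<le> (D * ?m + C * ?m) + (C * ?m + 4 * D' * ?m)"
      by (intro order.trans[OF card_Un_le] add_mono cA cL cE cS)
    also have "\<dots> = (D + 4 * D' + 2 * C) * ?m"
      by (simp add: algebra_simps)
    finally show ?thesis .
  qed
qed

section \<open>Iteration along the Ackermann function\<close>

lemma two_le_ackermann_Suc: "2 \<le> ackermann (Suc j) i"
proof (cases i)
  case 0
  then show ?thesis using less_ackermann[of 1 j] by simp
next
  case (Suc i')
  then show ?thesis using less_ackermann[of i "Suc j"] by linarith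
qed

text \<open>The double induction follows the recursion of \<open>ackermann\<close>: level
  \<open>Suc j\<close> uses groups of width \<open>ackermann (Suc j) i\<close> and handles the
  coarse matrix at level \<open>j\<close>. Each level multiplies the threshold by \<open>Q\<close>;
  the factor 6 absorbs the 4 and the 2 of \<open>few_rows_Suc_step\<close>.\<close>

lemma few_rows_Suc_ackermann:
  assumes few: "few_rows U r s Q C n" and r: "0 < r" and Q: "0 < Q"
  shows "few_rows U r (Suc s) (Suc Q * Q ^ j) (C * 6 ^ j * Suc i) (min n (ackermann j i))"
proof (induction j arbitrary: i)
  case 0
  have "few_rows U r (Suc s) (Suc Q) (C * min n (Suc i)) (min n (Suc i))"
    by (rule few_rows_Suc_quadratic[OF few r]) simp
  then show ?case
    by (rule few_rows_mono) (simp_all del: mult_Suc_right)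
next
  case (Suc j)
  show ?case
  proof (induction i)
    case 0
    show ?case
    proof (rule few_rows_mono[OF Suc.IH[of 1]])
      show "Suc Q * Q ^ j \<le> Suc Q * Q ^ Suc j" using Q by simp
    qed auto
  next
    case (Suc i)
    let ?t = "ackermann (Suc j) i"
    have "few_rows U r (Suc s) (Suc Q * Q ^ j * Q)
        (C * 6 ^ Suc j * Suc i + 4 * (C * 6 ^ j) + 2 * C) (min n (ackermann j ?t))"
    proof (rule few_rows_Suc_step[OF few r Q two_le_ackermann_Suc])
      show "few_rows U r (Suc s) (Suc Q * Q ^ j * Q) (C * 6 ^ Suc j * Suc i) (min n ?t)"
        using Suc.IH by (simp add: mult_ac)
      show "few_rows U r (Suc s) (Suc Q * Q ^ j) (C * 6 ^ j * Suc ?t) (min n (ackermann j ?t))"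
        by (rule \<open>\<And>i. few_rows U r (Suc s) (Suc Q * Q ^ j) (C * 6 ^ j * Suc i) (min n (ackermann j i))\<close>)
    qed
    then show ?case
    proof (rule few_rows_mono)
      have "2 * C * 1 \<le> 2 * C * 6 ^ j" by (intro mult_le_mono2) simp
      then show "C * 6 ^ Suc j * Suc i + 4 * (C * 6 ^ j) + 2 * C \<le> C * 6 ^ Suc j * Suc (Suc i)"
        by (simp add: algebra_simps)
    qed (simp_all add: mult_ac)
  qed
qed

text \<open>Level and index \<open>\<alpha>\<close> lift the width restriction, as
  \<open>ackermann \<alpha> \<alpha>\<close> is at least \<open>n\<close>. One more interval turns a
  threshold \<open>Q\<close> into at most \<open>Q ^ (\<alpha> + 2)\<close>.\<close>

lemma few_rows_inverse_ackermann:
  fixes n :: nat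
  defines "\<alpha> \<equiv> inverse_ackermann n"
  assumes r: "0 < r"
  shows "few_rows U r (Suc s) (2 ^ ((\<alpha> + 2) ^ s)) (r * (6 ^ \<alpha> * Suc \<alpha>) ^ s) n"
proof (induction s)
  case 0
  \<comment> \<open>Starting from threshold 2 makes \<open>Suc ?Q \<le> ?Q ^ 2\<close> available in
    the induction step.\<close>
  then show ?case using few_rows_1[OF r, of 2 U n] by simp
next
  case (Suc s)
  let ?Q = "2 ^ ((\<alpha> + 2) ^ s) :: nat"
  have "2 ^ 1 \<le> ?Q" by (intro power_increasing) auto
  then have Q: "0 < ?Q" and "2 * ?Q \<le> ?Q * ?Q"
    by (auto simp del: power_increasing_iff intro: mult_le_mono1)
  then have Q2: "Suc ?Q \<le> ?Q ^ 2"
    unfolding power2_eq_square by linarith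
  have n: "min n (ackermann \<alpha> \<alpha>) = n"
    using inverse_ackermann_props(2)[of n] by (simp add: \<alpha>_def)
  show ?case
  proof (rule few_rows_mono[OF few_rows_Suc_ackermann[OF Suc.IH r Q, of \<alpha> \<alpha>, unfolded n]])
    have "Suc ?Q * ?Q ^ \<alpha> \<le> ?Q ^ 2 * ?Q ^ \<alpha>" using Q2 by (rule mult_le_mono1)
    also have "\<dots> = 2 ^ ((\<alpha> + 2) ^ Suc s)"
      by (simp add: add.commute mult.commute flip: power_add power_mult)
    finally show "Suc ?Q * ?Q ^ \<alpha> \<le> 2 ^ ((\<alpha> + 2) ^ Suc s)" .
    show "r * (6 ^ \<alpha> * Suc \<alpha>) ^ s * 6 ^ \<alpha> * Suc \<alpha> \<le> r * (6 ^ \<alpha> * Suc \<alpha>) ^ Suc s"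
      by (simp only: power_Suc mult_ac order_refl)
  qed simp
qed

section \<open>From the number of rows to the number of ones\<close>

text \<open>Each row is cut into pieces of \<open>q\<close> consecutive ones, which are counted as
  rows of a new matrix labelled by pairs. Fewer than \<open>q\<close> ones per row are left over,
  whence the summand \<open>card R\<close>.\<close>

lemma sum_card_le_few_rows:
  fixes f :: "'a \<Rightarrow> nat set"
  assumes few: "few_rows (UNIV :: ('a \<times> nat) set) r s q C n" and s: "2 \<le> s" and q: "0 < q"
    and R: "finite R" "formation_free r s R f" and ab: "a \<le> b" "b - a \<le> n"
    and f: "\<And>x. x \<in> R \<Longrightarrow> f x \<subseteq> {a..<b}"
  shows "(\<Sum>x\<in>R. card (f x)) \<le> q * (C * (b - a) + card R)"
proof -
  define xs where "xs x = sorted_list_of_set (f x)" for x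
  define P where "P = (SIGMA x:R. {..<card (f x) div q})"
  define g where "g = (\<lambda>(x, i). (\<lambda>j. xs x ! j) ` {i * q..<i * q + q})"
  have xs: "sorted_wrt (<) (xs x)" "set (xs x) = f x" "length (xs x) = card (f x)" if "x \<in> R" for x
    using f[OF that] finite_subset[of "f x" "{a..<b}"]
    by (auto simp: xs_def strict_sorted_list_of_set)
  have piece: "x \<in> R" "i * q + q \<le> length (xs x)" if "(x, i) \<in> P" for x i
  proof -
    show x: "x \<in> R" using that by (simp add: P_def)
    have "Suc i \<le> card (f x) div q" using that by (simp add: P_def)
    then have "Suc i * q \<le> card (f x)" using q by (simp add: less_eq_div_iff_mult_less_eq)
    then show "i * q + q \<le> length (xs x)" using xs(3)[OF x] by simp
  qed
  have g_sub: "g (x, i) \<subseteq> f x" if "(x, i) \<in> P" for x i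
    using piece[OF that] xs(2)[of x] by (auto simp: g_def intro!: nth_mem)
  have "card P \<le> C * (b - a)"
  proof (rule few_rowsD[OF few, where f = g])
    show "finite P" using R(1) by (auto simp: P_def)
    fix p assume p: "p \<in> P"
    obtain x i where pxi: "p = (x, i)" by (cases p)
    show "g p \<subseteq> {a..<b}"
      using g_sub p f piece(1) unfolding pxi by blast
    have "inj_on (\<lambda>j. xs x ! j) {i * q..<i * q + q}"
      using xs(1) piece[of x i] p unfolding pxi by (intro inj_on_nth) (auto simp: strict_sorted_iff)
    then show "q \<le> card (g p)" by (simp add: pxi g_def card_image)
  next
    show "formation_free r s P g"
      unfolding formation_free_def
    proof (intro allI impI notI)
      fix S assume S: "S \<subseteq> P" "card S = r" "formation s S g"
      then obtain c where c: "mono c" "\<And>p i. p \<in> S \<Longrightarrow> i < s \<Longrightarrow> g p \<inter> {c i..<c (Suc i)} \<noteq> {}"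
        unfolding formation_def by blast
      \<comment> \<open>Pieces of one row are ordered left to right, so two of them cannot both meet two
        disjoint intervals.\<close>
      have no: False if ii': "(x, i) \<in> S" "(x, i') \<in> S" "i < i'" for x i i'
      proof -
        obtain y y' where y: "y \<in> g (x, i)" "c 1 \<le> y" "y' \<in> g (x, i')" "y' < c 1"
          using c(2)[OF ii'(1), of 1] c(2)[OF ii'(2), of 0] s by auto
        obtain j j' where j: "y = xs x ! j" "j < i * q + q" "y' = xs x ! j'" "i' * q \<le> j'"
          "j' < i' * q + q"
          using y by (auto simp: g_def)
        have P: "(x, i') \<in> P" using S(1) ii' by blast
        have "Suc i * q \<le> i' * q" using ii'(3) by (intro mult_le_mono1) simp
        then have "j < j'" using j by simp
        then have "y < y'"
          using xs(1)[OF piece(1)[OF P]] piece(2)[OF P] j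
          by (auto simp: sorted_wrt_iff_nth_less)
        then show False using y by simp
      qed
      have "inj_on fst S"
        by (rule inj_onI) (metis no linorder_neqE_nat prod.collapse)
      then have "card (fst ` S) = r" using S(2) by (simp add: card_image)
      moreover have "fst ` S \<subseteq> R" using S(1) by (auto simp: P_def)
      moreover have "formation s (fst ` S) f"
        unfolding formation_def using c g_sub S(1) by (intro exI[of _ c]) fastforce
      ultimately show False using R(2) unfolding formation_free_def by blast
    qed
  qed (use ab in auto)
  moreover have "card P = (\<Sum>x\<in>R. card (f x) div q)"
    using R(1) by (simp add: P_def)
  ultimately have le: "(\<Sum>x\<in>R. card (f x) div q) \<le> C * (b - a)" by simp
  have "card (f x) \<le> q * (card (f x) div q + 1)" for x
    using q by (simp add: dividend_less_times_div less_imp_le)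
  then have "(\<Sum>x\<in>R. card (f x)) \<le> (\<Sum>x\<in>R. q * (card (f x) div q + 1))"
    by (intro sum_mono)
  also have "\<dots> = q * ((\<Sum>x\<in>R. card (f x) div q) + card R)"
    unfolding sum_distrib_left[symmetric] by (simp only: sum.distrib card_eq_sum)
  also have "\<dots> \<le> q * (C * (b - a) + card R)"
    using le by simp
  finally show ?thesis .
qed

section \<open>The touches made by Greedy\<close>

text \<open>Indexed by list position, so that row \<open>t\<close> belongs to the access
  \<open>X ! t\<close>.\<close>

definition touched :: "nat tree \<Rightarrow> nat list \<Rightarrow> nat \<Rightarrow> nat set" where
  "touched T X t = {b. (b, int (Suc t)) \<in> greedy T X}"

lemma greedy_upto_iff:
  assumes "t \<le> length X"
  shows "p \<in> greedy_upto T X t \<longleftrightarrow> p \<in> greedy T X \<and> snd p \<le> int t"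
proof -
  have row: "snd p = t" if "p \<in> greedy_row S a t" for p S a t
    using that by (auto simp: greedy_row_def)
  have "(p \<in> greedy_upto T X t \<longleftrightarrow> p \<in> greedy_upto T X u \<and> snd p \<le> int t)" if "t \<le> u" for u
    using that
  proof (induction u rule: dec_induct)
    case base
    then show ?case using greedy_upto_subset[OF assms, of T] by auto
  next
    case (step u)
    then show ?case by (auto dest: row)
  qed
  from this[OF assms] show ?thesis by (simp add: greedy_def)
qed

lemma touched_subset:
  assumes "t < length X"
  shows "touched T X t \<subseteq> set X \<union> set_tree T"
  using greedy_upto_subset[of "length X" X T] by (auto simp: touched_def greedy_def)

lemma touched_iff_row:
  assumes "t < length X"
  shows "b \<in> touched T X t \<longleftrightarrow>
    (b, int (Suc t)) \<in> greedy_row (tree_points T \<union> greedy_upto T X t) (X ! t) (int (Suc t))"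
proof -
  have "b \<in> touched T X t \<longleftrightarrow> (b, int (Suc t)) \<in> greedy_upto T X (Suc t)"
    using greedy_upto_iff[of "Suc t" X "(b, int (Suc t))" T] assms by (simp add: touched_def)
  moreover have "(b, int (Suc t)) \<notin> greedy_upto T X t"
    using greedy_upto_iff[of t X "(b, int (Suc t))" T] assms by simp
  ultimately show ?thesis by simp
qed

lemma card_greedy: "card (greedy T X) = (\<Sum>t<length X. card (touched T X t))"
proof -
  have fin: "finite (touched T X t)" if "t < length X" for t
    using touched_subset[OF that] by (rule finite_subset) simp
  have "bij_betw (\<lambda>(t, b). (b, int (Suc t))) (SIGMA t:{..<length X}. touched T X t) (greedy T X)"
    unfolding bij_betw_def
  proof (intro conjI)
    show "inj_on (\<lambda>(t, b). (b, int (Suc t))) (SIGMA t:{..<length X}. touched T X t)"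
      by (auto simp: inj_on_def)
    show "(\<lambda>(t, b). (b, int (Suc t))) ` (SIGMA t:{..<length X}. touched T X t) = greedy T X"
    proof (intro equalityI subsetI)
      fix p assume p: "p \<in> greedy T X"
      obtain b s where bs: "p = (b, s)" by (cases p)
      have "1 \<le> s" "s \<le> int (length X)"
        using p greedy_upto_subset[of "length X" X T] unfolding greedy_def bs by auto
      then have s: "s = int (Suc (nat (s - 1)))" "nat (s - 1) < length X" by auto
      then have "(nat (s - 1), b) \<in> (SIGMA t:{..<length X}. touched T X t)"
        using p by (simp add: touched_def bs)
      then show "p \<in> (\<lambda>(t, b). (b, int (Suc t))) ` (SIGMA t:{..<length X}. touched T X t)"
        unfolding bs by (rule rev_image_eqI) (use s(1) in simp)
    qed (auto simp: touched_def)
  qed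
  then have "card (greedy T X) = card (SIGMA t:{..<length X}. touched T X t)"
    by (simp add: bij_betw_same_card)
  then show ?thesis using fin by simp
qed

text \<open>Greedy touches \<open>b\<close> only if the rectangle from the access to the last touch
  of \<open>b\<close> is otherwise empty. The touch of \<open>d\<close> lies in its column range, so
  the last touch of \<open>b\<close> must be more recent; it provides \<open>u\<close>.\<close>

lemma touched_unblocked:
  assumes t: "t < length X" and b: "b \<in> touched T X t" "b \<noteq> X ! t"
    and d: "min (X ! t) b \<le> d" "d \<le> max (X ! t) b" "d \<noteq> b" "d \<in> touched T X s" "s < t"
  shows "\<exists>u. s < u \<and> u < t \<and> b \<in> touched T X u"
proof -
  let ?S = "tree_points T \<union> greedy_upto T X t"
  let ?TT = "touch_times ?S b (int t)"
  let ?l = "last_touch ?S b (int t)"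
  have ne: "?TT \<noteq> {}" and empty: "rect (X ! t, int (Suc t)) (b, ?l) \<inter> ?S \<subseteq> {(b, ?l)}"
    using b unfolding touched_iff_row[OF t] greedy_row_def by auto
  have "?TT \<subseteq> {1 - int (height T)..int t}"
    using greedy_upto_subset[of t X T] t by (force simp: touch_times_def tree_points_def)
  then have "finite ?TT" by (rule finite_subset) simp
  then have "?l \<in> ?TT" unfolding last_touch_def using ne by (rule Max_in)
  then have l: "(b, ?l) \<in> ?S" "?l \<le> int t" by (auto simp: touch_times_def)
  have "(d, int (Suc s)) \<in> ?S"
    using d(4,5) t by (simp add: greedy_upto_iff touched_def)
  then have "(d, int (Suc s)) \<notin> rect (X ! t, int (Suc t)) (b, ?l)"
    using empty d(3) by blast
  then have less: "int (Suc s) < ?l"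
    using d l(2) by (auto simp: rect_def)
  \<comment> \<open>Tree points have time at most 1, whatever \<open>key_depth\<close> is, and
    \<open>?l\<close> is larger.\<close>
  then have "(b, ?l) \<notin> tree_points T" by (auto simp: tree_points_def)
  then have "(b, ?l) \<in> greedy T X" using l t by (simp add: greedy_upto_iff)
  then have "b \<in> touched T X (nat (?l - 1))" using less by (simp add: touched_def)
  then show ?thesis using less l(2) by (intro exI[of _ "nat (?l - 1)"]) auto
qed

text \<open>The first touch of \<open>b\<close> after time \<open>s\<close> cannot be caused by an access outside \<open>{a..c}\<close>:
  then \<open>a\<close> or \<open>c\<close> lies between the accessed key and \<open>b\<close> and was touched at least as recently.\<close>

lemma access_captured:
  assumes t: "t < length X" and st: "s < t" and abc: "a < b" "b < c"
    and touch: "a \<in> touched T X s" "c \<in> touched T X s" "b \<in> touched T X t"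
  shows "\<exists>u. s < u \<and> u \<le> t \<and> X ! u \<in> {a..c}"
proof -
  define u where "u = (LEAST u. s < u \<and> b \<in> touched T X u)"
  have u: "s < u" "b \<in> touched T X u"
    unfolding u_def using LeastI[of "\<lambda>u. s < u \<and> b \<in> touched T X u" t] st touch by auto
  have ut: "u \<le> t"
    unfolding u_def using st touch by (intro Least_le) simp
  have no: "\<not> (\<exists>v. s < v \<and> v < u \<and> b \<in> touched T X v)"
    using not_less_Least[of _ "\<lambda>u. s < u \<and> b \<in> touched T X u"] unfolding u_def by blast
  have "X ! u \<in> {a..c}"
  proof (rule ccontr)
    assume "X ! u \<notin> {a..c}"
    then consider "X ! u < a" | "c < X ! u" by force
    then show False
    proof cases
      case 1
      then show False
        using touched_unblocked[of u X b T a s] no u ut t abc touch by auto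
    next
      case 2
      then show False
        using touched_unblocked[of u X b T c s] no u ut t abc touch by auto
    qed
  qed
  then show ?thesis using u(1) ut by blast
qed

lemma contains_pattern_if_formation:
  assumes \<pi>: "\<pi> \<in> permutations_of_set {1..k}" and R: "R \<subseteq> {..<length X}" "card R = 2 * k"
    and F: "formation (3 * k) R (touched T X)"
  shows "contains_pattern X \<pi>"
proof -
  have len: "length \<pi> = k" and dist: "distinct \<pi>" and set: "set \<pi> = {1..k}"
    using \<pi> distinct_card[of \<pi>] by (auto simp: permutations_of_set_def)
  have "finite R" using R(1) by (rule finite_subset) simp
  define ts where "ts = sorted_list_of_set R"
  have ts: "length ts = 2 * k" "set ts = R" "sorted_wrt (<) ts"
    using \<open>finite R\<close> R(2) by (simp_all add: ts_def strict_sorted_list_of_set)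
  have ts_less: "ts ! i < ts ! j" if "i < j" "j < 2 * k" for i j
    using ts that by (simp add: sorted_wrt_iff_nth_less)
  have ts_R: "ts ! i \<in> R" if "i < 2 * k" for i
    using ts that nth_mem by metis
  obtain c where c: "mono c"
    "\<And>x i. x \<in> R \<Longrightarrow> i < 3 * k \<Longrightarrow> touched T X x \<inter> {c i..<c (Suc i)} \<noteq> {}"
    using F unfolding formation_def by blast
  \<comment> \<open>The zero-based value \<open>p i\<close> selects a triple of intervals.\<close>
  define p where "p i = \<pi> ! i - 1" for i
  have p: "p i < k" "\<pi> ! i = Suc (p i)" if "i < k" for i
  proof -
    have "\<pi> ! i \<in> {1..k}" using that len set nth_mem by metis
    then show "p i < k" "\<pi> ! i = Suc (p i)" by (auto simp: p_def)
  qed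
  \<comment> \<open>The earlier row meets the outer two intervals of the triple and the later row
    the middle one, so \<open>access_captured\<close> yields an access inside the triple.\<close>
  have "\<exists>u. ts ! (2 * i) < u \<and> u \<le> ts ! (2 * i + 1) \<and> X ! u \<in> {c (3 * p i)..<c (3 * p i + 3)}"
    if i: "i < k" for i
  proof -
    have R2: "ts ! (2 * i) \<in> R" "ts ! (2 * i + 1) \<in> R"
      using i by (auto intro: ts_R)
    obtain x where x: "x \<in> touched T X (ts ! (2 * i))" "c (3 * p i) \<le> x" "x < c (3 * p i + 1)"
      using c(2)[OF R2(1), of "3 * p i"] p[OF i] by auto
    obtain y where y: "y \<in> touched T X (ts ! (2 * i + 1))" "c (3 * p i + 1) \<le> y" "y < c (3 * p i + 2)"
      using c(2)[OF R2(2), of "3 * p i + 1"] p[OF i] by auto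
    obtain z where z: "z \<in> touched T X (ts ! (2 * i))" "c (3 * p i + 2) \<le> z" "z < c (3 * p i + 3)"
      using c(2)[OF R2(1), of "3 * p i + 2"] p[OF i] by (auto simp: numeral_3_eq_3)
    obtain u where "ts ! (2 * i) < u" "u \<le> ts ! (2 * i + 1)" "X ! u \<in> {x..z}"
      using access_captured[of "ts ! (2 * i + 1)" X "ts ! (2 * i)" x y z T] x y z R2 R(1) i
        ts_less[of "2 * i" "2 * i + 1"] by fastforce
    then show ?thesis using x z by (intro exI[of _ u]) auto
  qed
  then obtain u where u: "\<And>i. i < k \<Longrightarrow> ts ! (2 * i) < u i" "\<And>i. i < k \<Longrightarrow> u i \<le> ts ! (2 * i + 1)"
    "\<And>i. i < k \<Longrightarrow> X ! u i \<in> {c (3 * p i)..<c (3 * p i + 3)}"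
    by metis
  have order: "X ! u i < X ! u j" if "i < k" "j < k" "p i < p j" for i j
  proof -
    have "c (3 * p i + 3) \<le> c (3 * p j)" using that by (intro monoD[OF c(1)]) simp
    then show ?thesis using u(3)[of i] u(3)[of j] that by auto
  qed
  have inj: "i = j" if "i < k" "j < k" "p i = p j" for i j
    using that p dist len nth_eq_iff_index_eq by metis
  show ?thesis
    unfolding contains_pattern_def len
  proof (intro exI[of _ u] conjI allI impI)
    show "strict_mono_on {..<k} u"
    proof (rule strict_mono_onI)
      fix i j assume ij: "i \<in> {..<k}" "j \<in> {..<k}" "i < j"
      have "u i \<le> ts ! (2 * i + 1)" using u ij by simp
      also have "\<dots> < ts ! (2 * j)" using ij by (intro ts_less) auto
      also have "\<dots> < u j" using u ij by simp
      finally show "u i < u j" .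
    qed
    fix i assume i: "i < k"
    have "ts ! (2 * i + 1) < length X" using ts_R[of "2 * i + 1"] R(1) i by auto
    then show "u i < length X" using u(2)[OF i] by simp
    fix j assume j: "j < k"
    show "X ! u i < X ! u j \<longleftrightarrow> \<pi> ! i < \<pi> ! j"
      using order[OF i j] order[OF j i] inj[OF i j] p(2)[OF i] p(2)[OF j]
      by (cases "p i" "p j" rule: linorder_cases) auto
  qed
qed

section \<open>Arithmetic of the final bound\<close>

text \<open>Each of the two factors is at most \<open>2 ^ (\<alpha> ^ (6 * k))\<close>. Their
  product doubles the exponent, which the spare factor \<open>\<alpha> ^ k\<close> absorbs.\<close>

lemma exponent_bound:
  fixes \<alpha> k :: nat
  assumes \<alpha>: "2 \<le> \<alpha>" and k: "1 \<le> k"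
  shows "2 ^ ((\<alpha> + 2) ^ (3 * k - 1)) * (2 * k * (6 ^ \<alpha> * Suc \<alpha>) ^ (3 * k - 1) + 1) \<le>
    (2 :: nat) ^ (\<alpha> ^ (7 * k))"
proof -
  have "(6 :: nat) ^ \<alpha> * Suc \<alpha> \<le> 8 ^ \<alpha> * 2 ^ \<alpha>"
    by (intro mult_le_mono power_mono Suc_leI less_exp) auto
  also have "\<dots> = 2 ^ (4 * \<alpha>)"
    by (simp add: power_mult flip: power_mult_distrib)
  finally have "((6 :: nat) ^ \<alpha> * Suc \<alpha>) ^ (3 * k - 1) \<le> (2 ^ (4 * \<alpha>)) ^ (3 * k - 1)"
    by (rule power_mono) simp
  also have "\<dots> \<le> (2 ^ (4 * \<alpha>)) ^ (3 * k)"
    by (rule power_increasing) auto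
  also have "\<dots> = 2 ^ (12 * \<alpha> * k)" by (simp add: mult_ac flip: power_mult)
  finally have "2 * k * (6 ^ \<alpha> * Suc \<alpha>) ^ (3 * k - 1) + 1 \<le> 2 * k * 2 ^ (12 * \<alpha> * k) + 2 ^ (12 * \<alpha> * k)"
    by (intro add_mono mult_le_mono2) auto
  also have "\<dots> = Suc (2 * k) * 2 ^ (12 * \<alpha> * k)" by simp
  also have "\<dots> \<le> 2 ^ (2 * k) * 2 ^ (12 * \<alpha> * k)"
    by (intro mult_le_mono1 Suc_leI less_exp)
  also have "\<dots> = 2 ^ (2 * k + 12 * \<alpha> * k)" by (simp add: power_add)
  also have "\<dots> \<le> 2 ^ (\<alpha> ^ (6 * k))"
  proof (rule power_increasing)
    have "2 * k \<le> 4 * \<alpha> * k" using \<alpha> by (intro mult_le_mono1) simp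
    then have "2 * k + 12 * \<alpha> * k \<le> 16 * \<alpha> * k" by simp
    also have "\<dots> \<le> \<alpha> ^ 4 * \<alpha> * \<alpha> ^ k"
    proof (intro mult_le_mono order_refl)
      show "16 \<le> \<alpha> ^ 4" using power_mono[OF \<alpha>, of 4] by simp
      have "k \<le> 2 ^ k" using less_exp[of k] by simp
      also have "\<dots> \<le> \<alpha> ^ k" using \<alpha> by (intro power_mono) auto
      finally show "k \<le> \<alpha> ^ k" .
    qed
    also have "\<dots> = \<alpha> ^ (5 + k)" by (simp add: power_add numeral_eq_Suc)
    also have "\<dots> \<le> \<alpha> ^ (6 * k)" using \<alpha> k by (intro power_increasing) auto
    finally show "2 * k + 12 * \<alpha> * k \<le> \<alpha> ^ (6 * k)" .
  qed simp
  finally have "2 ^ ((\<alpha> + 2) ^ (3 * k - 1)) * (2 * k * (6 ^ \<alpha> * Suc \<alpha>) ^ (3 * k - 1) + 1) \<le>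
      (2 :: nat) ^ (\<alpha> ^ (6 * k)) * 2 ^ (\<alpha> ^ (6 * k))"
  proof (intro mult_le_mono power_increasing)
    have "2 * \<alpha> \<le> \<alpha> * \<alpha>" using \<alpha> by (rule mult_le_mono1)
    then have "\<alpha> + 2 \<le> \<alpha> ^ 2" using \<alpha> unfolding power2_eq_square by linarith
    then have "(\<alpha> + 2) ^ (3 * k - 1) \<le> (\<alpha> ^ 2) ^ (3 * k - 1)"
      by (rule power_mono) simp
    also have "\<dots> \<le> (\<alpha> ^ 2) ^ (3 * k)" using \<alpha> by (intro power_increasing) auto
    finally show "(\<alpha> + 2) ^ (3 * k - 1) \<le> \<alpha> ^ (6 * k)" by (simp flip: power_mult)
  qed simp_all
  also have "\<dots> = 2 ^ (2 * \<alpha> ^ (6 * k))" by (simp add: mult_2 power_add)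
  also have "\<dots> \<le> 2 ^ (\<alpha> ^ (7 * k))"
  proof (rule power_increasing)
    have "2 * \<alpha> ^ (6 * k) \<le> \<alpha> ^ Suc (6 * k)" using \<alpha> by simp
    also have "\<dots> \<le> \<alpha> ^ (7 * k)" using \<alpha> k by (intro power_increasing) auto
    finally show "2 * \<alpha> ^ (6 * k) \<le> \<alpha> ^ (7 * k)" .
  qed simp
  finally show ?thesis .
qed

section \<open>The exact bound for at most three keys\<close>

text \<open>For \<open>n \<le> 3\<close> the inverse Ackermann function is 1, so no choice of the constant helps and the
  bound \<open>2n\<close> has to be met exactly; it is attained for \<open>n = 3\<close>.\<close>

lemma card_greedy_3:
  assumes X: "X \<in> permutations_of_set {1..3}" and T: "set_tree T = {1..3}"
  shows "card (greedy T X) \<le> 6"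
proof -
  have dist: "distinct X" and set: "set X = {1..3}" using X by (auto simp: permutations_of_set_def)
  then have len: "length X = 3" using distinct_card[of X] by simp
  then obtain x y z where xyz: "X = [x, y, z]"
    by (metis (no_types) length_0_conv length_Suc_conv numeral_3_eq_3)
  have 3: "{1..3} = {1, 2, 3 :: nat}" by auto
  let ?f = "touched T X"
  have sub: "?f t \<subseteq> {1, 2, 3}" if "t < 3" for t
    using touched_subset[of t X T] that len set T 3 by auto
  have card: "card (?f t) = of_bool (1 \<in> ?f t) + of_bool (2 \<in> ?f t) + of_bool (3 \<in> ?f t)" if "t < 3" for t
  proof -
    have "card (?f t) = (\<Sum>b\<in>{1, 2, 3}. of_bool (b \<in> ?f t))"
      using sub[OF that] by (simp add: sum.If_cases Int_absorb1 of_bool_def del: sum.insert)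
    then show ?thesis by simp
  qed
  have sum: "card (greedy T X) = card (?f 0) + card (?f 1) + card (?f 2)"
    by (simp add: card_greedy len numeral_3_eq_3 numeral_2_eq_2)
  \<comment> \<open>No row lies strictly between consecutive rows, so a touched \<open>d\<close> in
    the column range blocks \<open>b\<close> outright.\<close>
  have K1: "d \<notin> ?f 0" if "b \<in> ?f 1" "b \<noteq> y" "min y b \<le> d" "d \<le> max y b" "d \<noteq> b" for b d
    using touched_unblocked[of 1 X b T d 0] that len by (auto simp: xyz)
  have K2: "d \<notin> ?f 1" if "b \<in> ?f 2" "b \<noteq> z" "min z b \<le> d" "d \<le> max z b" "d \<noteq> b" for b d
    using touched_unblocked[of 2 X b T d 1] that len by (auto simp: xyz)
  \<comment> \<open>Between rows 0 and 2, only row 1 can have renewed the touch of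
    \<open>b\<close>.\<close>
  have K3: "b \<in> ?f 1" if "b \<in> ?f 2" "b \<noteq> z" "min z b \<le> d" "d \<le> max z b" "d \<noteq> b" "d \<in> ?f 0" for b d
  proof -
    have "X ! 2 = z" by (simp add: xyz)
    then have "\<exists>u. 0 < u \<and> u < 2 \<and> b \<in> ?f u"
      using that len by (intro touched_unblocked[of 2 X b T d 0]) simp_all
    then obtain u where "0 < u" "u < 2" "b \<in> ?f u" by blast
    moreover from this have "u = 1" by simp
    ultimately show ?thesis by simp
  qed
  note K = K1[of 1 2] K1[of 1 3] K1[of 2 1] K1[of 2 3] K1[of 3 1] K1[of 3 2]
    K2[of 1 2] K2[of 1 3] K2[of 2 1] K2[of 2 3] K2[of 3 1] K2[of 3 2]
    K3[of 1 2] K3[of 1 3] K3[of 2 1] K3[of 2 3] K3[of 3 1] K3[of 3 2]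
  have "y \<in> {1, 2, 3}" "z \<in> {1, 2, 3}" "y \<noteq> z"
    using dist set unfolding xyz 3 by auto
  \<comment> \<open>Row 0 is left arbitrary, so \<open>y\<close> and \<open>z\<close> alone
    determine the constraints \<open>K\<close> on the nine memberships; each case is a finite
    check.\<close>
  then consider "y = 1" "z = 2" | "y = 1" "z = 3" | "y = 2" "z = 1"
    | "y = 2" "z = 3" | "y = 3" "z = 1" | "y = 3" "z = 2"
    by auto
  then have "of_bool (1 \<in> ?f 0) + of_bool (2 \<in> ?f 0) + of_bool (3 \<in> ?f 0)
      + (of_bool (1 \<in> ?f 1) + of_bool (2 \<in> ?f 1) + of_bool (3 \<in> ?f 1))
      + (of_bool (1 \<in> ?f 2) + of_bool (2 \<in> ?f 2) + of_bool (3 \<in> ?f 2)) \<le> (6 :: nat)"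
  proof cases
    case 1
    show ?thesis
      using K[unfolded 1, simplified] unfolding One_nat_def
      by (cases "1 \<in> ?f 0"; cases "2 \<in> ?f 0"; cases "3 \<in> ?f 0"; simp; smt (verit) of_bool_def)
  next
    case 2
    show ?thesis
      using K[unfolded 2, simplified] unfolding One_nat_def
      by (cases "1 \<in> ?f 0"; cases "2 \<in> ?f 0"; cases "3 \<in> ?f 0"; simp; smt (verit) of_bool_def)
  next
    case 3
    show ?thesis
      using K[unfolded 3, simplified] unfolding One_nat_def
      by (cases "1 \<in> ?f 0"; cases "2 \<in> ?f 0"; cases "3 \<in> ?f 0"; simp; smt (verit) of_bool_def)
  next
    case 4
    show ?thesis
      using K[unfolded 4, simplified] unfolding One_nat_def
      by (cases "1 \<in> ?f 0"; cases "2 \<in> ?f 0"; cases "3 \<in> ?f 0"; simp; smt (verit) of_bool_def)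
  next
    case 5
    show ?thesis
      using K[unfolded 5, simplified] unfolding One_nat_def
      by (cases "1 \<in> ?f 0"; cases "2 \<in> ?f 0"; cases "3 \<in> ?f 0"; simp; smt (verit) of_bool_def)
  next
    case 6
    show ?thesis
      using K[unfolded 6, simplified] unfolding One_nat_def
      by (cases "1 \<in> ?f 0"; cases "2 \<in> ?f 0"; cases "3 \<in> ?f 0"; simp; smt (verit) of_bool_def)
  qed
  then show ?thesis unfolding sum by (simp add: card)
qed

lemma card_greedy_small:
  assumes X: "X \<in> permutations_of_set {1..n}" and T: "set_tree T = {1..n}" and n: "n \<le> 3"
  shows "card (greedy T X) \<le> n * 2"
proof (cases "n = 3")
  case True
  then show ?thesis using card_greedy_3 X T by simp
next
  case False
  have set: "set X = {1..n}" and len: "length X = n"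
    using X distinct_card[of X] by (auto simp: permutations_of_set_def)
  \<comment> \<open>Here \<open>n \<le> 2\<close>, so the full grid is small enough.\<close>
  have "greedy T X \<subseteq> {1..n} \<times> {1..int n}"
    using greedy_upto_subset[of n X T] len set T by (simp add: greedy_def)
  then have "card (greedy T X) \<le> card ({1..n} \<times> {1..int n})"
    by (intro card_mono) auto
  also have "\<dots> = n * n" by (simp add: card_cartesian_product)
  also have "\<dots> \<le> n * 2" using False n by (intro mult_le_mono2) simp
  finally show ?thesis .
qed

theorem mainTheorem1:
  shows "\<exists>C :: nat. \<forall>(k :: nat) (n :: nat) (X :: nat list) (T :: nat tree).
           k \<ge> 1 \<longrightarrow>
           X \<in> permutations_of_set {1..n} \<longrightarrow>
           (\<exists>\<pi> \<in> permutations_of_set {1..k}. avoids_pattern X \<pi>) \<longrightarrow>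
           bst T \<longrightarrow> set_tree T = {1..n} \<longrightarrow>
           card (greedy T X) \<le> n * 2 ^ (inverse_ackermann n ^ (C * k))"
proof (intro exI[of _ 7] allI impI)
  fix k n :: nat and X :: "nat list" and T :: "nat tree"
  assume k: "1 \<le> k" and X: "X \<in> permutations_of_set {1..n}"
    and avoid: "\<exists>\<pi> \<in> permutations_of_set {1..k}. avoids_pattern X \<pi>" and T: "set_tree T = {1..n}"
  let ?\<alpha> = "inverse_ackermann n"
  have set: "set X = {1..n}" and len: "length X = n"
    using X distinct_card[of X] by (auto simp: permutations_of_set_def)
  show "card (greedy T X) \<le> n * 2 ^ (?\<alpha> ^ (7 * k))"
  \<comment> \<open>For \<open>?\<alpha> = 1\<close> the power is 1 for any constant, and
    \<open>n \<le> 3\<close>. Otherwise \<open>exponent_bound\<close> accounts for the constant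
    7.\<close>
  proof (cases "?\<alpha> = 1")
    case True
    then have "n \<le> ackermann 1 1" using inverse_ackermann_props(2)[of n] by simp
    also have "ackermann 1 1 = 3" by (simp add: numeral_eq_Suc)
    finally show ?thesis using card_greedy_small[OF X T] True by simp
  next
    case False
    then have \<alpha>: "2 \<le> ?\<alpha>" using inverse_ackermann_props(1)[of n] by simp
    let ?q = "2 ^ ((?\<alpha> + 2) ^ (3 * k - 1)) :: nat"
    let ?C = "2 * k * (6 ^ ?\<alpha> * Suc ?\<alpha>) ^ (3 * k - 1)"
    have few: "few_rows (UNIV :: (nat \<times> nat) set) (2 * k) (3 * k) ?q ?C n"
      using few_rows_inverse_ackermann[of "2 * k" UNIV "3 * k - 1" n] k by simp
    \<comment> \<open>A violating set of \<open>2 * k\<close> rows would force every pattern of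
      length \<open>k\<close>, including the avoided one.\<close>
    have free: "formation_free (2 * k) (3 * k) {..<n} (touched T X)"
      using avoid contains_pattern_if_formation[of _ k _ X T] unfolding formation_free_def len by blast
    have "touched T X t \<subseteq> {1..<Suc n}" if "t < n" for t
      using touched_subset[of t X T] that len set T by auto
    then have "card (greedy T X) \<le> ?q * (?C * (Suc n - 1) + card {..<n})"
      unfolding card_greedy len using k
      by (intro sum_card_le_few_rows[OF few _ _ _ free]) auto
    also have "\<dots> = n * (?q * (?C + 1))" by (simp add: algebra_simps)
    also have "\<dots> \<le> n * 2 ^ (?\<alpha> ^ (7 * k))"
      by (intro mult_le_mono2 exponent_bound \<alpha> k)
    finally show ?thesis .
  qed
qed

end
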